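(* Let $q$ be a prime power with $q\equiv 1\pmod 4$, let $b\in\mathbb{F}_q$ with $b^2=-1$, let $f(x)=(x+1)(x+b)\in\mathbb{F}_q[x]$, and let $\alpha\in\mathbb{F}_{q^4}$ be normal over $\mathbb{F}_q$. Let $u,v\in\mathbb{F}_q^*$. If $\gamma=u\,L_f(\alpha)+v$ is primitive in $\mathbb{F}_{q^4}$, then $\gamma$ is $2$-normal over $\mathbb{F}_q$.
   Context: For $h(x)=\sum_i a_ix^i\in\mathbb{F}_q[x]$, $L_h(\alpha)=\sum_i a_i\alpha^{q^i}$. An element $\alpha\in\mathbb{F}_{q^n}$ is normal over $\mathbb{F}_q$ if $\alpha,\alpha^q,\dots,\alpha^{q^{n-1}}$ form an $\mathbb{F}_q$-basis of $\mathbb{F}_{q^n}$; it is primitive if it generates $\mathbb{F}_{q^n}^*$. For $\alpha\in\mathbb{F}_{q^n}$ let $g_\alpha(x)=\sum_{i=0}^{n-1}\alpha^{q^i}x^{n-1-i}$; $\alpha$ is $k$-normal over $\mathbb{F}_q$ if $\gcd(x^n-1,g_\alpha(x))$ in $\mathbb{F}_{q^n}[x]$ has degree $k$ (here $n=4$). *)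

theory Defs
  imports "HOL-Computational_Algebra.Computational_Algebra"
begin

text \<open>The ambient finite field is a type 'a of cardinality q^n; the base field F_q is
  realised as its unique subfield of order q, namely the fixed points of x \<mapsto> x^q.\<close>

definition base_field :: "nat \<Rightarrow> 'a::field set" where
  "base_field q = {x. x ^ q = x}"

definition prime_power :: "nat \<Rightarrow> bool" where
  "prime_power q \<longleftrightarrow> (\<exists>p k. prime p \<and> k > 0 \<and> q = p ^ k)"

definition linearized :: "nat \<Rightarrow> 'a::field poly \<Rightarrow> 'a \<Rightarrow> 'a" where
  "linearized q h \<alpha> = (\<Sum>i\<le>degree h. coeff h i * \<alpha> ^ (q ^ i))"

definition normal_elem :: "nat \<Rightarrow> nat \<Rightarrow> 'a::field \<Rightarrow> bool" where
  "normal_elem q n \<alpha> \<longleftrightarrow>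
     (\<forall>c. (\<forall>i<n. c i \<in> base_field q) \<and> (\<Sum>i<n. c i * \<alpha> ^ (q ^ i)) = 0 \<longrightarrow> (\<forall>i<n. c i = 0))
   \<and> (\<forall>x. \<exists>c. (\<forall>i<n. c i \<in> base_field q) \<and> x = (\<Sum>i<n. c i * \<alpha> ^ (q ^ i)))"

definition primitive_elem :: "'a::field \<Rightarrow> bool" where
  "primitive_elem \<gamma> \<longleftrightarrow> \<gamma> \<noteq> 0 \<and> (\<forall>x. x \<noteq> 0 \<longrightarrow> (\<exists>k::nat. \<gamma> ^ k = x))"

definition g_poly :: "nat \<Rightarrow> nat \<Rightarrow> 'a::field \<Rightarrow> 'a poly" where
  "g_poly q n \<alpha> = (\<Sum>i<n. monom (\<alpha> ^ (q ^ i)) (n - 1 - i))"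

definition k_normal :: "nat \<Rightarrow> nat \<Rightarrow> nat \<Rightarrow> 'a::field_gcd \<Rightarrow> bool" where
  "k_normal q n k \<alpha> \<longleftrightarrow> degree (gcd (monom 1 n - 1) (g_poly q n \<alpha>)) = k"

end

theory Submission
  imports Defs "HOL-Number_Theory.Residues"
begin

(* For a fourth root of unity c ~= 1 in F_q the Frobenius
   equivariance of L_f gives g_gamma(c) = u f(c) g_alpha(c), and g_alpha(c) ~= 0 by normality
   of alpha; so of c = -1, b, -b exactly the roots -1, -b of f are roots of g_gamma.
   At c = 1 one finds g_gamma(1) = 2 (1 + b) (gamma^q - b gamma), because (x - b) f(x) =
   x^3 + x^2 + x + 1; and gamma^q = b gamma would give gamma^(4(q-1)) = 1, impossible for a
   primitive element of F_(q^4).  As x^4 - 1 = (x - 1)(x + 1)(x - b)(x + b) has distinct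
   roots, gcd(x^4 - 1, g_gamma) = (x + 1)(x + b). *)

lemma power_card_eq_self:
  fixes x :: "'a::{field,finite}"
  shows "x ^ card (UNIV :: 'a set) = x"
proof (cases "x = 0")
  case False
  have "x * (\<Prod>y\<in>UNIV-{0}. x * y) = x * x ^ (card (UNIV :: 'a set) - 1) * \<Prod>(UNIV-{0})"
    by (simp add: prod.distrib mult_ac)
  also have "x * x ^ (card (UNIV :: 'a set) - 1) = x ^ Suc (card (UNIV :: 'a set) - 1)"
    by (subst power_Suc) auto
  also have "Suc (card (UNIV :: 'a set) - 1) = card (UNIV :: 'a set)"
    using finite_UNIV_card_ge_0[where ?'a = 'a] by simp
  also have "(\<Prod>y\<in>UNIV-{0}. x * y) = (\<Prod>y\<in>UNIV-{0}. y)"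
    by (rule prod.reindex_bij_witness[of _ "\<lambda>y. y / x" "\<lambda>y. x * y"]) (use False in auto)
  finally show ?thesis
    by simp
qed (use finite_UNIV_card_ge_0[where ?'a = 'a] in auto)

lemma card_field_ge_2: "card (UNIV :: 'a::{field,finite} set) \<ge> 2"
  using card_mono[of UNIV "{0, 1 :: 'a}"] by simp

lemma base_field_power:
  assumes "c \<in> base_field q"
  shows "c ^ q ^ i = c"
proof (induction i)
  case (Suc i)
  then show ?case
    using assms by (simp add: base_field_def power_mult)
qed simp

lemma poly_g_poly: "poly (g_poly q n \<alpha>) c = (\<Sum>i<n. c ^ (n - 1 - i) * \<alpha> ^ q ^ i)"
  by (simp add: g_poly_def poly_sum poly_monom mult.commute)

lemma sum_root_of_unity_shift:
  fixes c :: "'a::comm_ring_1"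
  assumes "c ^ n = 1" and periodic: "\<And>i. x (i + n) = x i"
  shows "(\<Sum>i<n. c ^ (n - 1 - i) * x (i + j)) = c ^ j * (\<Sum>i<n. c ^ (n - 1 - i) * x i)"
proof (induction j)
  case (Suc j)
  have step: "(\<Sum>i<n. c ^ (n - 1 - i) * y (Suc i)) = c * (\<Sum>i<n. c ^ (n - 1 - i) * y i)"
    if "y n = y 0" for y
  proof (cases n)
    case (Suc m)
    have "(\<Sum>i<n. c ^ (n - 1 - i) * y (Suc i)) = (\<Sum>i<m. c ^ (m - i) * y (Suc i)) + y n"
      using Suc by (simp add: sum.lessThan_Suc)
    also have "\<dots> = c ^ n * y 0 + (\<Sum>i<m. c * c ^ (m - Suc i) * y (Suc i))"
      using assms(1) that by (simp add: Suc_diff_Suc flip: power_Suc)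
    also have "\<dots> = c * (\<Sum>i<n. c ^ (n - 1 - i) * y i)"
      using Suc
      by (simp del: sum.lessThan_Suc add: sum.lessThan_Suc_shift sum_distrib_left distrib_left mult.assoc)
    finally show ?thesis .
  qed simp
  show ?case
    using step[of "\<lambda>i. x (i + j)"] periodic[of j] Suc.IH by (simp add: add.commute)
qed simp

lemma normal_elem_poly_g_poly_ne_0:
  assumes "normal_elem q n \<alpha>" and "c \<in> base_field q" and "n > 0"
  shows "poly (g_poly q n \<alpha>) c \<noteq> 0"
proof
  assume "poly (g_poly q n \<alpha>) c = 0"
  moreover have "\<forall>i<n. c ^ (n - 1 - i) \<in> base_field q"
    using assms(2) by (simp add: base_field_def) (metis power_mult mult.commute)
  ultimately have "\<forall>i<n. c ^ (n - 1 - i) = 0"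
    using assms(1) spec[of _ "\<lambda>i. c ^ (n - 1 - i)"] unfolding normal_elem_def poly_g_poly by blast
  then show False
    using assms(3) by (metis diff_less diff_self_eq_0 less_one power_0 zero_neq_one)
qed

context
  fixes q n :: nat
  assumes prime_power_q: "prime_power q"
    and card_field: "card (UNIV :: 'a::{field,finite} set) = q ^ n"
begin

lemma prime_CHAR: "prime CHAR('a)"
  by (rule prime_CHAR_semidom) (simp add: finite_imp_CHAR_pos)

lemma q_power_eq_CHAR_power: "\<exists>k. q ^ i = CHAR('a) ^ k"
proof -
  obtain p k where p: "prime p" "q = p ^ k"
    using prime_power_q unfolding prime_power_def by blast
  have "CHAR('a) dvd p ^ (k * n)"
    using CHAR_dvd_CARD[where 'a = 'a] card_field p(2) by (simp add: power_mult)
  then have "CHAR('a) = p"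
    using prime_CHAR p(1) prime_dvd_power primes_dvd_imp_eq by blast
  with p(2) show ?thesis
    by (metis power_mult)
qed

lemma frobenius_sum: "(sum f A) ^ q ^ i = (\<Sum>j\<in>A. f j ^ q ^ i :: 'a)"
  using q_power_eq_CHAR_power freshmans_dream_sum'[OF prime_CHAR] by blast

lemma frobenius_add: "(x + y) ^ q ^ i = x ^ q ^ i + (y :: 'a) ^ q ^ i"
  using q_power_eq_CHAR_power freshmans_dream'[OF prime_CHAR] by blast

lemma q_ge_2: "q \<ge> 2"
  using card_field card_field_ge_2[where 'a = 'a] power_le_one[of q n] by (cases "q \<ge> 2") auto

lemma exponent_pos: "n > 0"
  using card_field card_field_ge_2[where 'a = 'a] by (cases n) auto

lemma base_field_add:
  "x \<in> base_field q \<Longrightarrow> y \<in> base_field q \<Longrightarrow> x + (y :: 'a) \<in> base_field q"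
  using frobenius_add[of x y 1] by (simp add: base_field_def)

lemma base_field_uminus:
  assumes "x \<in> base_field q"
  shows "- (x :: 'a) \<in> base_field q"
proof -
  have "0 = (x + - x) ^ q"
    using q_ge_2 by simp
  also have "\<dots> = x + (- x) ^ q"
    using frobenius_add[of x "- x" 1] assms by (simp add: base_field_def)
  finally have "(- x) ^ q = - x"
    by (simp add: eq_neg_iff_add_eq_0 add.commute)
  then show ?thesis
    by (simp add: base_field_def)
qed

lemma two_ne_zero_if_odd:
  assumes "odd q"
  shows "(2 :: 'a) \<noteq> 0"
proof
  assume "(2 :: 'a) = 0"
  then have "CHAR('a) = 2"
    using of_nat_eq_0_iff_char_dvd[where 'a = 'a, of 2] primes_dvd_imp_eq[OF prime_CHAR two_is_prime_nat]
    by simp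
  then obtain k where "q = 2 ^ k"
    using q_power_eq_CHAR_power[of 1] by auto
  then show False
    using assms q_ge_2 by (cases k) auto
qed

lemma coeffs_linear_product_in_base_field:
  assumes "a \<in> base_field q" and "b \<in> base_field q"
  shows "set (coeffs ([:a, 1:] * [:b, 1 :: 'a:])) \<subseteq> base_field q"
proof -
  have "[:a, 1:] * [:b, 1:] = [:a * b, a + b, 1 :: 'a:]"
    by (simp add: algebra_simps)
  moreover have "a * b \<in> base_field q" "1 \<in> base_field q"
    using assms by (simp_all add: base_field_def power_mult_distrib)
  ultimately show ?thesis
    using base_field_add[OF assms] by (auto simp: cCons_def mult.commute add.commute)
qed

lemma frobenius_periodic: "\<alpha> ^ q ^ (i + n) = (\<alpha> :: 'a) ^ q ^ i"
  using power_card_eq_self[of "\<alpha> ^ q ^ i"] card_field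
  by (simp add: power_add mult.commute flip: power_mult)

(* HOL-Algebra, imported through Residues for CHAR_dvd_CARD, also declares coeff and monom;
   hence the qualified names Polynomial.coeff and Polynomial.monom. *)
lemma coeff_in_base_field:
  assumes "set (coeffs h) \<subseteq> base_field q"
  shows "Polynomial.coeff h j \<in> base_field q"
proof (cases "j \<le> degree h \<and> h \<noteq> 0")
  case True
  then show ?thesis
    using assms coeff_in_coeffs by blast
next
  case False
  then have "Polynomial.coeff h j = 0"
    by (auto simp: coeff_eq_0)
  moreover have "q > 0"
    using q_ge_2 by simp
  ultimately show ?thesis
    by (simp add: base_field_def)
qed

lemma linearized_power:
  assumes "set (coeffs h) \<subseteq> base_field q"
  shows "linearized q h \<alpha> ^ q ^ i
    = (\<Sum>j\<le>degree h. Polynomial.coeff h j * (\<alpha> :: 'a) ^ q ^ (i + j))"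
  unfolding linearized_def frobenius_sum
  by (simp add: power_mult_distrib base_field_power coeff_in_base_field[OF assms] power_add mult.commute
      flip: power_mult)

(* That is, g of L_h(alpha) is congruent to h * g_alpha modulo x^n - 1. *)
lemma poly_g_poly_linearized:
  assumes "c ^ n = 1" and "set (coeffs h) \<subseteq> base_field q"
  shows "poly (g_poly q n (linearized q h \<alpha>)) c = poly h c * poly (g_poly q n (\<alpha> :: 'a)) c"
proof -
  have "poly (g_poly q n (linearized q h \<alpha>)) c
      = (\<Sum>j\<le>degree h. Polynomial.coeff h j * (\<Sum>i<n. c ^ (n - 1 - i) * \<alpha> ^ q ^ (i + j)))"
    by (simp add: poly_g_poly linearized_power assms(2) sum_distrib_left mult_ac sum.swap[of _ "{..<n}"])
  also have "\<dots> = (\<Sum>j\<le>degree h. Polynomial.coeff h j * c ^ j) * poly (g_poly q n \<alpha>) c"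
    unfolding poly_g_poly sum_root_of_unity_shift[where x = "\<lambda>i. \<alpha> ^ q ^ i", OF assms(1) frobenius_periodic]
    by (simp add: sum_distrib_right mult_ac)
  finally show ?thesis
    by (simp add: poly_altdef)
qed

lemma poly_g_poly_affine:
  assumes "u \<in> base_field q" and "v \<in> base_field q"
  shows "poly (g_poly q n (u * \<beta> + v)) c
    = u * poly (g_poly q n \<beta>) c + v * (\<Sum>i<n. c ^ i :: 'a)"
proof -
  have "(u * \<beta> + v) ^ q ^ i = u * \<beta> ^ q ^ i + v" for i
    by (simp add: frobenius_add power_mult_distrib base_field_power assms)
  then have "poly (g_poly q n (u * \<beta> + v)) c
      = u * poly (g_poly q n \<beta>) c + v * (\<Sum>i<n. c ^ (n - Suc i))"
    by (simp add: poly_g_poly distrib_left sum.distrib sum_distrib_left mult_ac)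
  then show ?thesis
    by (simp only: sum.nat_diff_reindex)
qed

lemma poly_g_poly_affine_linearized_eq_0_iff:
  fixes \<alpha> :: 'a
  assumes "normal_elem q n \<alpha>" and "set (coeffs h) \<subseteq> base_field q"
    and "u \<in> base_field q" "u \<noteq> 0" "v \<in> base_field q"
    and "c \<in> base_field q" "c ^ n = 1" "c \<noteq> 1"
  shows "poly (g_poly q n (u * linearized q h \<alpha> + v)) c = 0 \<longleftrightarrow> poly h c = 0"
proof -
  have "(\<Sum>i<n. c ^ i) = 0"
    using geometric_sum[OF assms(8), of n] assms(7) by simp
  then have "poly (g_poly q n (u * linearized q h \<alpha> + v)) c
      = u * poly h c * poly (g_poly q n \<alpha>) c"
    using poly_g_poly_affine[OF assms(3,5)] poly_g_poly_linearized[OF assms(7,2)] by simp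
  then show ?thesis
    using normal_elem_poly_g_poly_ne_0[OF assms(1,6) exponent_pos] assms(4) by simp
qed

end

lemma degree_gcd_eq_card_common_roots:
  fixes X P :: "'a::field_gcd poly"
  assumes "X \<noteq> 0" and "card {r. poly X r = 0} = degree X"
  shows "degree (gcd X P) = card {r. poly X r = 0 \<and> poly P r = 0}"
proof -
  define d where "d = gcd X P"
  obtain e where X: "X = d * e"
    unfolding d_def by (metis dvd_def gcd_dvd1)
  have "d \<noteq> 0" "e \<noteq> 0"
    using assms(1) X by auto
  have "degree X = card {r. poly X r = 0}"
    using assms(2) by simp
  also have "\<dots> \<le> card {r. poly d r = 0} + card {r. poly e r = 0}"
    unfolding X poly_mult mult_eq_0_iff Collect_disj_eq by (rule card_Un_le)
  finally have "degree d \<le> card {r. poly d r = 0}"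
    using card_poly_roots_bound[OF \<open>e \<noteq> 0\<close>] \<open>d \<noteq> 0\<close> \<open>e \<noteq> 0\<close> X
    by (simp add: degree_mult_eq)
  then have "degree d = card {r. poly d r = 0}"
    using card_poly_roots_bound[OF \<open>d \<noteq> 0\<close>] by simp
  moreover have "poly d r = 0 \<longleftrightarrow> poly X r = 0 \<and> poly P r = 0" for r
    unfolding d_def poly_eq_0_iff_dvd using dvd_trans by auto
  ultimately show ?thesis
    unfolding d_def by simp
qed

lemma primitive_elem_power_eq_1_imp_card_le:
  fixes \<gamma> :: "'a::{field,finite}"
  assumes "primitive_elem \<gamma>" and "\<gamma> ^ N = 1" and "N > 0"
  shows "card (UNIV :: 'a set) - 1 \<le> N"
proof -
  have "UNIV - {0} \<subseteq> (\<lambda>k. \<gamma> ^ k) ` {..<N}"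
  proof
    fix x :: 'a
    assume "x \<in> UNIV - {0}"
    then obtain k where "\<gamma> ^ k = x"
      using assms(1) unfolding primitive_elem_def by auto
    moreover have "\<gamma> ^ k = \<gamma> ^ (k mod N)"
      by (metis assms(2) mult_div_mod_eq power_add power_mult power_one mult_1)
    ultimately show "x \<in> (\<lambda>k. \<gamma> ^ k) ` {..<N}"
      using assms(3) by auto
  qed
  then have "card (UNIV - {0 :: 'a}) \<le> card ((\<lambda>k. \<gamma> ^ k) ` {..<N})"
    by (intro card_mono) auto
  also have "\<dots> \<le> N"
    using card_image_le[of "{..<N}" "\<lambda>k. \<gamma> ^ k"] by simp
  finally show ?thesis
    by (simp add: card_Diff_singleton)
qed

lemma fourth_roots_of_unity:
  fixes b c :: "'a::idom"
  assumes "b ^ 2 = -1"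
  shows "c ^ 4 = 1 \<longleftrightarrow> c \<in> {1, -1, b, -b}"
proof -
  have "(c - b) * (c + b) = c ^ 2 - b ^ 2" "(c - 1) * (c + 1) = c ^ 2 - 1"
    by (simp_all add: power2_eq_square algebra_simps)
  moreover have "c ^ 4 - 1 = (c ^ 2 - 1) * (c ^ 2 + 1)"
    by (simp add: power2_eq_square power4_eq_xxxx algebra_simps)
  ultimately have "c ^ 4 - 1 = (c - 1) * (c + 1) * (c - b) * (c + b)"
    using assms by (simp add: mult.assoc)
  then show ?thesis
    by (auto simp: add_eq_0_iff2 minus_equation_iff[of b])
qed

lemma distinct_fourth_roots_of_unity:
  fixes b :: "'a::idom"
  assumes "b ^ 2 = -1" and "(2 :: 'a) \<noteq> 0"
  shows "distinct [1, -1, b, -b]"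
proof -
  have "(1 :: 'a) \<noteq> -1"
    using assms(2) by (metis add_eq_0_iff2 one_add_one)
  moreover from this have "1 \<noteq> b" "-1 \<noteq> b"
    using assms(1) by auto
  moreover from this have "1 \<noteq> -b" "-1 \<noteq> -b"
    by (metis minus_minus)+
  moreover have "b \<noteq> -b"
  proof
    assume "b = -b"
    then have "2 * b = 0"
      by (metis add_eq_0_iff2 mult_2)
    then show False
      using assms by auto
  qed
  ultimately show ?thesis
    by simp
qed

lemma degree_monom_minus_1:
  assumes "n > 0"
  shows "degree (Polynomial.monom (1 :: 'a::comm_ring_1) n - 1) = n"
proof -
  have "degree (Polynomial.monom (1 :: 'a) n + (- 1)) = n"
    using assms by (subst degree_add_eq_left) (simp_all add: degree_monom_eq)
  then show ?thesis
    by simp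
qed

lemma degree_gcd_x4_minus_1:
  fixes b :: "'a::field_gcd"
  assumes "b ^ 2 = -1" and "(2 :: 'a) \<noteq> 0"
  shows "degree (gcd (Polynomial.monom 1 4 - 1) P) = card {c \<in> {1, -1, b, -b}. poly P c = 0}"
proof -
  define X :: "'a poly" where "X = Polynomial.monom 1 4 - 1"
  have roots_X: "{c. poly X c = 0} = {1, -1, b, -b}"
    using fourth_roots_of_unity[OF assms(1)] by (auto simp: X_def poly_monom)
  have "degree X = 4"
    unfolding X_def by (rule degree_monom_minus_1) simp
  moreover have "card {1, -1, b, -b} = 4"
    using distinct_card[OF distinct_fourth_roots_of_unity[OF assms]] by simp
  ultimately have "degree (gcd X P) = card {c. poly X c = 0 \<and> poly P c = 0}"
    by (intro degree_gcd_eq_card_common_roots) (auto simp: roots_X)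
  also have "{c. poly X c = 0 \<and> poly P c = 0} = {c \<in> {1, -1, b, -b}. poly P c = 0}"
    using roots_X by blast
  finally show ?thesis
    unfolding X_def .
qed

lemma primitive_elem_power_q_ne:
  fixes \<gamma> c :: "'a::{field,finite}"
  assumes "primitive_elem \<gamma>" and "card (UNIV :: 'a set) = q ^ 4" and "q \<ge> 2" and "c ^ 4 = 1"
  shows "\<gamma> ^ q \<noteq> c * \<gamma>"
proof
  assume eigen: "\<gamma> ^ q = c * \<gamma>"
  have "\<gamma> \<noteq> 0"
    using assms(1) unfolding primitive_elem_def by simp
  moreover have "\<gamma> ^ (q - 1) * \<gamma> = \<gamma> ^ q"
    using assms(3) by (simp flip: power_Suc2)
  ultimately have "\<gamma> ^ (q - 1) = c"
    using eigen by simp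
  then have "\<gamma> ^ (4 * (q - 1)) = 1"
    using assms(4) by (simp add: power_mult mult.commute)
  then have "q ^ 4 - 1 \<le> 4 * (q - 1)"
    using primitive_elem_power_eq_1_imp_card_le[OF assms(1)] assms(2,3) by fastforce
  moreover have "q * 2 ^ 3 \<le> q * q ^ 3"
    using assms(3) by (intro mult_le_mono2 power_mono) auto
  then have "8 * q \<le> q ^ 4"
    by (simp add: eval_nat_numeral)
  ultimately show False
    using assms(3) by linarith
qed

lemma poly_g_poly_1_ne_0:
  fixes b u v \<alpha> :: "'a::{field,finite}"
  assumes q: "prime_power q" and card: "card (UNIV :: 'a set) = q ^ 4"
    and b: "b \<in> base_field q" "b ^ 2 = -1" and two: "(2 :: 'a) \<noteq> 0"
    and uv: "u \<in> base_field q" "v \<in> base_field q"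
    and primitive: "primitive_elem (u * linearized q ([:1, 1:] * [:b, 1:]) \<alpha> + v)"
  shows "poly (g_poly q 4 (u * linearized q ([:1, 1:] * [:b, 1:]) \<alpha> + v)) 1 \<noteq> 0"
proof -
  define h :: "'a poly" where "h = [:1, 1:] * [:b, 1:]"
  define \<beta> where "\<beta> = linearized q h \<alpha>"
  define \<gamma> where "\<gamma> = u * \<beta> + v"
  define tr where "tr = (\<Sum>i<4. \<alpha> ^ q ^ i)"
  have h: "h = [:b, 1 + b, 1:]"
    by (simp add: h_def algebra_simps)
  have h_base: "set (coeffs h) \<subseteq> base_field q"
    unfolding h_def using coeffs_linear_product_in_base_field[OF q card _ b(1), of 1]
    by (simp add: base_field_def)
  have conj: "\<beta> ^ q ^ i = b * \<alpha> ^ q ^ i + (1 + b) * \<alpha> ^ q ^ (i + 1) + \<alpha> ^ q ^ (i + 2)"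
    for i
    unfolding \<beta>_def linearized_power[OF q card h_base] by (simp add: h numeral_2_eq_2)
  have bb: "b * b = -1" "b * (b * x) = - x" for x
    using b(2) by (simp_all add: power2_eq_square flip: mult.assoc)
  have "\<beta> ^ q - b * \<beta> = tr"
    using conj[of 0] conj[of 1] by (simp add: tr_def eval_nat_numeral algebra_simps bb)
  then have frobenius: "\<gamma> ^ q = b * \<gamma> + u * tr + (1 - b) * v"
    using frobenius_add[OF q card, of "u * \<beta>" v 1] uv unfolding \<gamma>_def base_field_def
    by (simp add: power_mult_distrib algebra_simps)
  have "poly (g_poly q 4 \<gamma>) 1 = u * poly h 1 * tr + 4 * v"
    unfolding \<gamma>_def \<beta>_def poly_g_poly_affine[OF q card uv]
      poly_g_poly_linearized[OF q card power_one h_base]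
    by (simp add: poly_g_poly tr_def eval_nat_numeral)
  also have "\<dots> = 2 * (1 + b) * (\<gamma> ^ q - b * \<gamma>)"
    by (simp add: frobenius h algebra_simps bb)
  finally have trace: "poly (g_poly q 4 \<gamma>) 1 = 2 * (1 + b) * (\<gamma> ^ q - b * \<gamma>)" .
  have "1 + b \<noteq> 0"
    using distinct_fourth_roots_of_unity[OF b(2) two] by (auto simp: add_eq_0_iff2)
  moreover have "b ^ 4 = 1"
    using b(2) power_mult[of b 2 2] by simp
  then have "\<gamma> ^ q \<noteq> b * \<gamma>"
    unfolding \<gamma>_def \<beta>_def h_def
    by (rule primitive_elem_power_q_ne[OF primitive card q_ge_2[OF q card]])
  ultimately have "poly (g_poly q 4 \<gamma>) 1 \<noteq> 0"
    unfolding trace mult_eq_0_iff right_minus_eq using two by blast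
  then show ?thesis
    unfolding \<gamma>_def \<beta>_def h_def .
qed

lemma roots_g_poly_at_nontrivial_fourth_roots:
  fixes b u v \<alpha> :: "'a::{field,finite}"
  assumes q: "prime_power q" and card: "card (UNIV :: 'a set) = q ^ 4"
    and b: "b \<in> base_field q" "b ^ 2 = -1" and two: "(2 :: 'a) \<noteq> 0"
    and "normal_elem q 4 \<alpha>" and "u \<in> base_field q" "u \<noteq> 0" "v \<in> base_field q"
  shows "{c \<in> {-1, b, -b}. poly (g_poly q 4 (u * linearized q ([:1, 1:] * [:b, 1:]) \<alpha> + v)) c = 0}
    = {-1, -b}"
proof -
  define h :: "'a poly" where "h = [:1, 1:] * [:b, 1:]"
  have one: "1 \<in> base_field q"
    by (simp add: base_field_def)
  have distinct: "distinct [1, -1, b, -b]"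
    by (rule distinct_fourth_roots_of_unity[OF b(2) two])
  have root_iff:
    "poly (g_poly q 4 (u * linearized q h \<alpha> + v)) c = 0 \<longleftrightarrow> poly h c = 0"
    if "c \<in> {-1, b, -b}" for c
  proof (rule poly_g_poly_affine_linearized_eq_0_iff[OF q card assms(6) _ assms(7-9)])
    show "set (coeffs h) \<subseteq> base_field q"
      unfolding h_def by (rule coeffs_linear_product_in_base_field[OF q card one b(1)])
    show "c \<in> base_field q"
      using that b(1) one base_field_uminus[OF q card] by auto
    show "c ^ 4 = 1" "c \<noteq> 1"
      using that distinct fourth_roots_of_unity[OF b(2)] by auto
  qed
  have "poly h b = (1 + b) * (2 * b)"
    by (simp add: h_def algebra_simps)
  moreover have "1 + b \<noteq> 0" "b \<noteq> 0"
    using distinct by (auto simp: add_eq_0_iff2)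
  ultimately have "poly h b \<noteq> 0"
    using two by simp
  moreover have "poly h (-1) = 0" "poly h (-b) = 0"
    by (simp_all add: h_def)
  ultimately have
    "{c \<in> {-1, b, -b}. poly (g_poly q 4 (u * linearized q h \<alpha> + v)) c = 0} = {-1, -b}"
    using root_iff by auto
  then show ?thesis
    unfolding h_def .
qed

theorem lemma7p1:
  fixes q :: nat and b u v \<alpha> :: "'a::{field_gcd,finite}"
  assumes "prime_power q" and "q mod 4 = 1"
    and "card (UNIV :: 'a set) = q ^ 4"
    and "b \<in> base_field q" and "b ^ 2 = -1"
    and "normal_elem q 4 \<alpha>"
    and "u \<in> base_field q" "u \<noteq> 0" and "v \<in> base_field q" "v \<noteq> 0"
    and "primitive_elem (u * linearized q ([:1, 1:] * [:b, 1:]) \<alpha> + v)"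
  shows "k_normal q 4 2 (u * linearized q ([:1, 1:] * [:b, 1:]) \<alpha> + v)"
proof -
  define \<gamma> where "\<gamma> = u * linearized q ([:1, 1:] * [:b, 1:]) \<alpha> + v"
  have "odd q"
    using assms(2) by presburger
  then have two: "(2 :: 'a) \<noteq> 0"
    by (rule two_ne_zero_if_odd[OF assms(1,3)])
  have distinct: "distinct [1, -1, b, -b]"
    by (rule distinct_fourth_roots_of_unity[OF assms(5) two])
  have "poly (g_poly q 4 \<gamma>) 1 \<noteq> 0"
    unfolding \<gamma>_def by (rule poly_g_poly_1_ne_0[OF assms(1,3,4,5) two assms(7,9,11)])
  moreover have "{c \<in> {-1, b, -b}. poly (g_poly q 4 \<gamma>) c = 0} = {-1, -b}"
    unfolding \<gamma>_def by (rule roots_g_poly_at_nontrivial_fourth_roots[OF assms(1,3,4,5) two assms(6-9)])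
  ultimately have "{c \<in> {1, -1, b, -b}. poly (g_poly q 4 \<gamma>) c = 0} = {-1, -b}"
    by auto
  then have "degree (gcd (Polynomial.monom 1 4 - 1) (g_poly q 4 \<gamma>)) = card {-1, -b}"
    by (simp only: degree_gcd_x4_minus_1[OF assms(5) two])
  also have "card {-1, -b} = 2"
    using distinct by simp
  finally show ?thesis
    unfolding k_normal_def \<gamma>_def .
qed

end
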